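(* Let $R$ be a ring such that every subring of $R$ is a Jacobson radical ring. Then $R$ is nil, i.e. every element of $R$ is nilpotent.
   Context: Rings are associative and are not assumed to have an identity element; subrings are accordingly not required to contain an identity (a subring is an additive subgroup closed under multiplication). In particular $R$ is a subring of itself. A ring $S$ is called a Jacobson radical ring if the Jacobson radical of $S$ equals $S$; equivalently, for every $a\in S$ there is $a'\in S$ with $a+a'+aa'=a+a'+a'a=0$. *)

theory Defs
  imports Main
begin

text \<open>The type class \<open>ring\<close> is the class of associative rings without assumed identity. A ring
  \<open>R\<close> is the universe of a type of this class, and a subring is a subset of that universe.\<close>

definition subring :: "'a::ring set \<Rightarrow> bool" where
  "subring S \<longleftrightarrow> 0 \<in> S \<and> (\<forall>x\<in>S. \<forall>y\<in>S. x + y \<in> S) \<and> (\<forall>x\<in>S. - x \<in> S) \<and> (\<forall>x\<in>S. \<forall>y\<in>S. x * y \<in> S)"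

definition right_ideal :: "'a::ring set \<Rightarrow> 'a set \<Rightarrow> bool" where
  "right_ideal S I \<longleftrightarrow> I \<subseteq> S \<and> 0 \<in> I \<and> (\<forall>x\<in>I. \<forall>y\<in>I. x + y \<in> I) \<and> (\<forall>x\<in>I. - x \<in> I) \<and>
     (\<forall>x\<in>I. \<forall>s\<in>S. x * s \<in> I)"

definition modular_right_ideal :: "'a::ring set \<Rightarrow> 'a set \<Rightarrow> bool" where
  "modular_right_ideal S I \<longleftrightarrow> right_ideal S I \<and> (\<exists>e\<in>S. \<forall>x\<in>S. x - e * x \<in> I)"

definition maximal_right_ideal :: "'a::ring set \<Rightarrow> 'a set \<Rightarrow> bool" where
  "maximal_right_ideal S M \<longleftrightarrow> right_ideal S M \<and> M \<noteq> S \<and>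
     (\<forall>I. right_ideal S I \<longrightarrow> M \<subseteq> I \<longrightarrow> I = M \<or> I = S)"

text \<open>For a ring without identity, the Jacobson radical is the intersection of the modular
  maximal right ideals; it is the whole ring if there are none.\<close>

definition jacobson_radical :: "'a::ring set \<Rightarrow> 'a set" where
  "jacobson_radical S = {x \<in> S. \<forall>M. modular_right_ideal S M \<and> maximal_right_ideal S M \<longrightarrow> x \<in> M}"

definition jacobson_radical_ring :: "'a::ring set \<Rightarrow> bool" where
  "jacobson_radical_ring S \<longleftrightarrow> jacobson_radical S = S"

text \<open>The class \<open>ring\<close> has no \<open>1\<close>, hence no power operation. Here \<open>pow_Suc a n\<close> is the power of
  \<open>a\<close> with exponent \<open>n + 1\<close>, so that exactly the positive exponents occur.\<close>

primrec pow_Suc :: "'a::ring \<Rightarrow> nat \<Rightarrow> 'a" where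
  "pow_Suc a 0 = a"
| "pow_Suc a (Suc n) = a * pow_Suc a n"

definition nilpotent_elem :: "'a::ring \<Rightarrow> bool" where
  "nilpotent_elem a \<longleftrightarrow> (\<exists>n. pow_Suc a n = 0)"

definition nil_ring :: "'a::ring set \<Rightarrow> bool" where
  "nil_ring S \<longleftrightarrow> (\<forall>a\<in>S. nilpotent_elem a)"

lemma modular_maximal_exists:
  fixes S :: "'a::ring set"
  assumes I: "right_ideal S I" and e: "e \<in> S" "e \<notin> I" and mod: "\<forall>x\<in>S. x - e * x \<in> I"
  shows "\<exists>M. modular_right_ideal S M \<and> maximal_right_ideal S M \<and> e \<notin> M"
proof -
  define F where "F = {J. right_ideal S J \<and> I \<subseteq> J \<and> e \<notin> J}"
  have "\<exists>M\<in>F. \<forall>X\<in>F. M \<subseteq> X \<longrightarrow> X = M"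
  proof (rule subset_Zorn_nonempty)
    show "F \<noteq> {}" using I e by (auto simp: F_def)
  next
    fix C assume C: "C \<noteq> {}" "subset.chain F C"
    have ri: "right_ideal S J" "I \<subseteq> J" "e \<notin> J" if "J \<in> C" for J
      using that C(2) by (auto simp: subset.chain_def F_def)
    have add: "x + y \<in> \<Union> C" if xy: "x \<in> \<Union> C" "y \<in> \<Union> C" for x y
    proof -
      obtain X Y where XY: "X \<in> C" "x \<in> X" "Y \<in> C" "y \<in> Y" using xy by auto
      have "X \<subseteq> Y \<or> Y \<subseteq> X" using C(2) XY by (auto simp: subset_chain_def)
      then obtain Z where "Z \<in> C" "x \<in> Z" "y \<in> Z" using XY by blast
      then show ?thesis using ri(1)[of Z] by (auto simp: right_ideal_def)
    qed
    have "right_ideal S (\<Union> C)"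
      using C(1) ri(1) add unfolding right_ideal_def by (intro conjI ballI) blast+
    then show "\<Union> C \<in> F" using C(1) ri(2,3) by (auto simp: F_def)
  qed
  then obtain M where M: "M \<in> F" and mx: "\<And>X. X \<in> F \<Longrightarrow> M \<subseteq> X \<Longrightarrow> X = M" by blast
  have M': "right_ideal S M" "I \<subseteq> M" "e \<notin> M" using M by (auto simp: F_def)
  have "X = S" if X: "right_ideal S X" "M \<subseteq> X" "X \<noteq> M" for X
  proof -
    have eX: "e \<in> X" using mx[of X] X M'(2) by (auto simp: F_def)
    have "x \<in> X" if "x \<in> S" for x
    proof -
      have "x - e * x \<in> X" "e * x \<in> X" using that mod eX X M'(2) by (auto simp: right_ideal_def)
      then have "(x - e * x) + e * x \<in> X" using X(1) unfolding right_ideal_def by blast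
      then show ?thesis by simp
    qed
    then show ?thesis using X(1) by (auto simp: right_ideal_def)
  qed
  then have "maximal_right_ideal S M" using M' e(1) by (auto simp: maximal_right_ideal_def)
  moreover have "modular_right_ideal S M" using M' mod e(1) by (auto simp: modular_right_ideal_def)
  ultimately show ?thesis using M'(3) by blast
qed

lemma jacobson_radical_ring_iff:
  fixes S :: "'a::ring set"
  assumes S: "subring S"
  shows "jacobson_radical_ring S \<longleftrightarrow>
    (\<forall>a\<in>S. \<exists>a'\<in>S. a + a' + a * a' = 0 \<and> a + a' + a' * a = 0)"
proof
  assume J: "jacobson_radical_ring S"
  have right: "\<exists>b\<in>S. a + b + a * b = 0" if a: "a \<in> S" for a
  proof (rule ccontr)
    assume no: "\<not> ?thesis"
    define I where "I = (\<lambda>x. x + a * x) ` S"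
    have "right_ideal S I"
      unfolding right_ideal_def
    proof (intro conjI ballI)
      show "I \<subseteq> S" using S a by (auto simp: I_def subring_def)
      show "0 \<in> I" using S by (force simp: I_def subring_def)
    next
      fix x y assume "x \<in> I" "y \<in> I"
      then obtain u v where "u \<in> S" "v \<in> S" "x = u + a * u" "y = v + a * v" by (auto simp: I_def)
      moreover then have "x + y = (u + v) + a * (u + v)" by (simp add: algebra_simps)
      ultimately show "x + y \<in> I" using S unfolding I_def subring_def by blast
    next
      fix x assume "x \<in> I"
      then obtain u where "u \<in> S" "x = u + a * u" by (auto simp: I_def)
      moreover then have "- x = (- u) + a * (- u)" by (simp add: algebra_simps)
      ultimately show "- x \<in> I" using S unfolding I_def subring_def by blast
    next
      fix x s assume "x \<in> I" "s \<in> S"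
      moreover then obtain u where "u \<in> S" "x = u + a * u" by (auto simp: I_def)
      moreover then have "x * s = (u * s) + a * (u * s)" by (simp add: algebra_simps)
      ultimately show "x * s \<in> I" using S unfolding I_def subring_def by blast
    qed
    moreover have "- a \<in> S" using S a by (simp add: subring_def)
    moreover have "- a \<notin> I"
    proof
      assume "- a \<in> I"
      then obtain x where x: "x \<in> S" "- a = x + a * x" by (auto simp: I_def)
      then have "a + x + a * x = 0" by (metis add.assoc add.right_inverse)
      then show False using no x by blast
    qed
    moreover have "\<forall>x\<in>S. x - (- a) * x \<in> I" by (auto simp: I_def)
    ultimately obtain M where "modular_right_ideal S M" "maximal_right_ideal S M" "- a \<notin> M"
      using modular_maximal_exists by blast
    then show False using J \<open>- a \<in> S\<close> unfolding jacobson_radical_ring_def jacobson_radical_def by blast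
  qed
  show "\<forall>a\<in>S. \<exists>a'\<in>S. a + a' + a * a' = 0 \<and> a + a' + a' * a = 0"
  proof
    fix a assume "a \<in> S"
    then obtain b where b: "b \<in> S" "a + b + a * b = 0" using right by blast
    then obtain c where c: "c \<in> S" "b + c + b * c = 0" using right by blast
    have "a = a + (b + c + b * c) + a * (b + c + b * c)" using c(2) by simp
    also have "\<dots> = (a + b + a * b) + c + (a + b + a * b) * c" by (simp add: algebra_simps)
    also have "\<dots> = c" using b(2) by simp
    finally have "a = c" .
    then show "\<exists>a'\<in>S. a + a' + a * a' = 0 \<and> a + a' + a' * a = 0"
      using b c by (auto simp: add.commute)
  qed
next
  assume Q: "\<forall>a\<in>S. \<exists>a'\<in>S. a + a' + a * a' = 0 \<and> a + a' + a' * a = 0"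
  have False if M: "modular_right_ideal S M" "maximal_right_ideal S M" for M
  proof -
    obtain e where e: "e \<in> S" "\<forall>x\<in>S. x - e * x \<in> M" and ri: "right_ideal S M"
      using M(1) by (auto simp: modular_right_ideal_def)
    have "- e \<in> S" using e S by (auto simp: subring_def)
    then obtain x where x: "x \<in> S" "- e + x + (- e) * x = 0" using Q by blast
    then have "e = x - e * x" by (simp add: algebra_simps)
    then have eM: "e \<in> M" using e(2) x(1) by metis
    have "y \<in> M" if "y \<in> S" for y
    proof -
      have "y - e * y \<in> M" "e * y \<in> M" using that e(2) eM ri by (auto simp: right_ideal_def)
      then have "(y - e * y) + e * y \<in> M" using ri unfolding right_ideal_def by blast
      then show ?thesis by simp
    qed
    then have "M = S" using ri by (auto simp: right_ideal_def)
    then show False using M(2) by (simp add: maximal_right_ideal_def)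
  qed
  then show "jacobson_radical_ring S"
    unfolding jacobson_radical_ring_def jacobson_radical_def by blast
qed

end

theory Submission
  imports Defs "HOL-Computational_Algebra.Polynomial" "HOL-Computational_Algebra.Primes"
begin

text \<open>
  Fix \<open>a \<in> R\<close> and let \<open>I\<close> be the ideal of those \<open>p \<in> \<int>[X]\<close> with \<open>p(a) \<cdot> a = 0\<close>. The subring
  generated by \<open>a\<close> consists of the elements \<open>p(a) \<cdot> a\<close>, and quasi-inverses inside it make every
  polynomial with constant term \<open>1\<close> a unit modulo \<open>I\<close>: the class of \<open>X\<close> lies in the Jacobson
  radical of \<open>\<int>[X]/I\<close>. Now \<open>\<int>[X]/I\<close> is a finitely generated commutative ring, hence a Jacobson
  ring, so \<open>X\<close> should be nilpotent modulo \<open>I\<close>, which says that \<open>a\<close> is nilpotent. For this ring the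
  Nullstellensatz has a short direct proof, in two halves.

  Characteristic zero (\<open>torsion_power_mem\<close>): some \<open>e X\<^sup>r\<close> with \<open>e \<noteq> 0\<close> lies in \<open>I\<close>. Otherwise a
  nonzero element of \<open>I\<close> of least degree is \<open>X\<^sup>r u\<close> with \<open>u\<close> nonconstant, of nonzero constant term
  \<open>c\<close> and leading coefficient \<open>l\<close>. Modulo \<open>I\<close>, the integer \<open>c\<close> acts on \<open>X\<^sup>r\<close> as a multiple of \<open>X\<close>,
  so every integer \<open>d \<equiv> 1\<close> modulo \<open>c\<close> is invertible on \<open>X\<^sup>r\<close>. Pseudo-division by \<open>X\<^sup>r u\<close> has
  remainder \<open>0\<close> on \<open>I\<close>, so \<open>d\<close> is invertible modulo \<open>u\<close> up to a power of \<open>l\<close>. For \<open>d > 1\<close>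
  coprime to \<open>l\<close> this is impossible, as \<open>u\<close> keeps its positive degree modulo \<open>d\<close>.

  Positive characteristic (\<open>power_mem_if_torsion\<close>): inverting \<open>1 - X\<close> puts into \<open>I\<close> a polynomial
  with value \<open>-1\<close> at \<open>1\<close>, which therefore is nonzero modulo every prime. Its lowest term modulo a
  prime \<open>q\<close> is a power of \<open>X\<close> times a unit modulo \<open>q\<close> and \<open>I\<close>, so the factor \<open>q\<close> can be removed
  from \<open>e\<close> at the price of a higher power of \<open>X\<close>.
\<close>

section \<open>Integer polynomials\<close>

text \<open>The case \<open>q = 0\<close> splits off the largest power of \<open>X\<close> that divides \<open>P\<close>.\<close>

lemma lowest_term_modulo:
  fixes P :: "int poly" and q :: int
  assumes "\<not> [:q:] dvd P"
  obtains j W R where "P = [:q:] * W + monom 1 j * R" "\<not> q dvd coeff R 0"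
proof -
  have ex: "\<exists>j. \<not> q dvd coeff P j" using assms by (simp add: const_poly_dvd_iff)
  define j where "j = (LEAST j. \<not> q dvd coeff P j)"
  have j: "\<not> q dvd coeff P j" unfolding j_def using ex by (rule LeastI_ex)
  have below: "q dvd coeff P i" if "i < j" for i
    using not_less_Least that unfolding j_def by blast
  have "[:q:] dvd poly_cutoff j P"
    using below by (simp add: const_poly_dvd_iff coeff_poly_cutoff)
  then obtain W where W: "poly_cutoff j P = [:q:] * W" by (auto simp: dvd_def)
  have "P = poly_cutoff j P + monom 1 j * poly_shift j P"
    by (rule poly_eqI)
      (simp add: coeff_poly_cutoff coeff_poly_shift coeff_monom_mult del: monom_eq_1_iff)
  moreover have "\<not> q dvd coeff (poly_shift j P) 0" using j by (simp add: coeff_poly_shift)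
  ultimately show thesis using that W by metis
qed

text \<open>Modulo \<open>d\<close> the leading coefficient of \<open>u\<close> is a unit, so a nonzero multiple of \<open>u\<close> has degree
  at least that of \<open>u\<close>, which is positive; so no nonzero constant is a multiple of \<open>u\<close>.\<close>

lemma dvd_const_if_multiple_const_modulo:
  fixes u Q V :: "int poly" and d L :: int
  assumes eq: "u * Q = [:L:] + [:d:] * V"
    and cop: "coprime d (lead_coeff u)" and deg: "degree u \<noteq> 0"
  shows "d dvd L"
proof -
  have pos: "d dvd coeff (u * Q) m" if "m > 0" for m
    using that by (cases m) (auto simp: eq)
  have Q: "d dvd coeff Q i" for i
  proof (induction "degree Q - i" arbitrary: i rule: less_induct)
    case less
    have above: "d dvd coeff Q i'" if "i < i'" for i'
    proof (cases "i' \<le> degree Q")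
      case True
      then show ?thesis using that by (intro less) linarith
    next
      case False
      then show ?thesis by (simp add: coeff_eq_0)
    qed
    let ?n = "degree u" and ?f = "\<lambda>k. coeff u k * coeff Q (degree u + i - k)"
    have "coeff (u * Q) (?n + i) = ?f ?n + sum ?f ({..?n + i} - {?n})"
      by (simp add: coeff_mult sum.remove[of _ ?n])
    moreover have "d dvd sum ?f ({..?n + i} - {?n})"
    proof (rule dvd_sum)
      fix k assume "k \<in> {..?n + i} - {?n}"
      then have "k < ?n \<or> k > ?n" by auto
      then show "d dvd ?f k"
      proof
        assume "k < ?n"
        then show ?thesis by (intro dvd_mult above) linarith
      qed (simp add: coeff_eq_0)
    qed
    moreover have "d dvd coeff (u * Q) (?n + i)" using deg by (intro pos) simp
    ultimately have "d dvd ?f ?n" by (simp only: dvd_add_left_iff)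
    then show ?case using cop by (simp add: coprime_dvd_mult_right_iff)
  qed
  have "L = coeff u 0 * coeff Q 0 - d * coeff V 0"
    using arg_cong[OF eq, of "\<lambda>p. coeff p 0"] by (simp add: coeff_mult_0)
  then show ?thesis using Q by simp
qed

section \<open>Ideals of integer polynomials with X in the Jacobson radical of the quotient\<close>

text \<open>An element \<open>x\<close> of a commutative ring lies in the Jacobson radical exactly when every
  \<open>1 + x y\<close> is a unit. For the class of \<open>X\<close> in \<open>\<int>[X]/I\<close> these elements are represented by the
  polynomials \<open>pCons 1 p\<close>.\<close>

locale radical_poly_ideal =
  fixes I :: "int poly set"
  assumes zero_mem: "0 \<in> I"
    and add_mem: "p \<in> I \<Longrightarrow> q \<in> I \<Longrightarrow> p + q \<in> I"
    and mult_mem: "p \<in> I \<Longrightarrow> r * p \<in> I"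
    and unit: "\<exists>s. pCons 1 p * s - 1 \<in> I"
begin

lemma diff_mem: "p \<in> I \<Longrightarrow> q \<in> I \<Longrightarrow> p - q \<in> I"
  using add_mem[of p "(- 1) * q"] mult_mem[of q "- 1"] by simp

lemma cancel_unit:
  assumes "pCons 1 p * f \<in> I"
  shows "f \<in> I"
proof -
  obtain s where s: "pCons 1 p * s - 1 \<in> I" using unit by blast
  have "f = s * (pCons 1 p * f) - f * (pCons 1 p * s - 1)" by (simp add: algebra_simps)
  then show ?thesis using assms s by (metis diff_mem mult_mem)
qed

lemma ex_mem_poly_1_eq:
  obtains P where "P \<in> I" "poly P 1 = - 1"
proof -
  obtain s where "pCons 1 [:- 1:] * s - 1 \<in> I" using unit by blast
  then show thesis by (rule that) simp
qed

text \<open>Each prime factor \<open>q\<close> of \<open>e\<close> can be removed: let \<open>r X\<^sup>j\<close> be the lowest term modulo \<open>q\<close> of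
  an element of \<open>I\<close> that is nonzero modulo \<open>q\<close>. Once \<open>r\<close> is scaled to \<open>1\<close> modulo \<open>q\<close>, that
  element is \<open>X\<^sup>j\<close> times some \<open>1 + X p\<close> up to multiples of \<open>q\<close>, which are harmless on
  \<open>(e/q) X\<^sup>k\<close>, and \<open>1 + X p\<close> cancels.\<close>

lemma power_mem_if_torsion:
  assumes "e > 0" "monom (int e) k \<in> I"
  shows "\<exists>n. monom 1 n \<in> I"
  using assms
proof (induction e arbitrary: k rule: less_induct)
  case (less e)
  show ?case
  proof (cases "e = 1")
    case True
    then show ?thesis using less.prems by auto
  next
    case False
    then obtain q where q: "prime q" "q dvd e" using prime_factor_nat by blast
    then obtain e' where e': "e = q * e'" by blast
    have lt: "e' < e" "e' > 0" using q(1) less.prems(1) e' prime_gt_1_nat[of q] by auto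
    obtain P where P: "P \<in> I" "poly P 1 = - 1" by (rule ex_mem_poly_1_eq)
    have "\<not> [:int q:] dvd P"
    proof
      assume "[:int q:] dvd P"
      then have "int q dvd poly P 1" by (auto simp: dvd_def)
      then show False using P(2) q(1) by auto
    qed
    then obtain j W R where PW: "P = [:int q:] * W + monom 1 j * R" and R: "\<not> int q dvd coeff R 0"
      by (rule lowest_term_modulo)
    obtain r g where Rg: "R = pCons r g" by (cases R)
    have "coprime r (int q)"
      using R Rg q(1) prime_imp_coprime[of "int q" r] by (simp add: coprime_commute)
    then obtain v w where vw: "v * r + w * int q = 1"
      using bezout_int[of r "int q"] by (metis coprime_imp_gcd_eq_1)
    let ?E = "monom (int e') k"
    have qE: "[:int q:] * ?E \<in> I" using less.prems(2) by (simp add: e' smult_monom)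
    have one: "pCons 1 (smult v g) = [:v:] * R + [:w:] * [:int q:]"
      using vw by (simp add: Rg mult.commute)
    have "pCons 1 (smult v g) * (monom 1 j * ?E)
        = ([:v:] * ?E) * P + ([:w:] * monom 1 j - [:v:] * W) * ([:int q:] * ?E)"
      unfolding one PW by (simp only: algebra_simps)
    then have "pCons 1 (smult v g) * (monom 1 j * ?E) \<in> I"
      using P(1) qE by (simp only: add_mem mult_mem)
    then have "monom 1 j * ?E \<in> I" by (rule cancel_unit)
    then have "monom (int e') (j + k) \<in> I" by (simp add: mult_monom)
    then show ?thesis using less.IH lt by blast
  qed
qed

text \<open>On \<open>X\<^sup>r\<close>, where \<open>X\<^sup>r (c + X g) \<in> I\<close>, the integer \<open>1 + t c\<close> acts as \<open>1 - t X g\<close>, which is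
  invertible. This produces an integer \<open>d\<close> with \<open>X\<^sup>r (d s - 1) \<in> I\<close> and \<open>d\<close> coprime to the leading
  coefficient of \<open>c + X g\<close>.\<close>

lemma torsion_power_mem:
  obtains e r where "e \<noteq> 0" "monom e r \<in> I"
proof -
  obtain P where "P \<in> I" "poly P 1 = - 1" by (rule ex_mem_poly_1_eq)
  then have "P \<in> I \<and> P \<noteq> 0" by auto
  then obtain f where f: "f \<in> I" "f \<noteq> 0"
    and least: "\<And>p. p \<in> I \<Longrightarrow> degree p < degree f \<Longrightarrow> p = 0"
    using exists_least_iff[of "\<lambda>n. \<exists>p. p \<in> I \<and> p \<noteq> 0 \<and> degree p = n"] by metis
  have "\<not> [:0:] dvd f" using f(2) by simp
  then obtain r W u where "f = [:0:] * W + monom 1 r * u" "\<not> 0 dvd coeff u 0"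
    by (rule lowest_term_modulo)
  then have fu: "f = monom 1 r * u" and u0: "coeff u 0 \<noteq> 0" by auto
  obtain c g where ug: "u = pCons c g" by (cases u)
  show thesis
  proof (cases "degree u = 0")
    case True
    then have "g = 0" using ug by (simp split: if_splits)
    then have "f = monom c r" using ug fu by (simp add: smult_monom)
    then show ?thesis using that f(1) u0 ug by simp
  next
    case False
    define l where "l = lead_coeff u"
    have l: "l \<noteq> 0" using False by (auto simp: l_def)
    have c: "c \<noteq> 0" using u0 ug by simp
    \<comment> \<open>Any multiple \<open>t\<close> of \<open>l\<close> makes \<open>1 + t c\<close> coprime to \<open>l\<close>; this one also makes it exceed \<open>1\<close>,
      as \<open>t c\<close> is twice a nonzero square.\<close>
    define t where "t = 2 * c * l * l"
    define d where "d = 1 + t * c"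
    have "d = 1 + 2 * (c * l)\<^sup>2" by (simp add: d_def t_def power2_eq_square)
    moreover have "(c * l)\<^sup>2 > 0" using c l by simp
    ultimately have d1: "d > 1" by linarith
    have "d = 2 * c * c * l * l + 1" by (simp add: d_def t_def)
    then have cop: "coprime d l"
      by (metis coprime_1_left coprime_iff_gcd_eq_1 gcd.commute gcd_add_mult mult.commute)
    obtain s where s: "pCons 1 (smult (- t) g) * s - 1 \<in> I" using unit by blast
    have one: "pCons 1 (smult (- t) g) = [:d:] - [:t:] * u" by (simp add: ug d_def)
    have "monom 1 r * ([:d:] * s - 1)
        = monom 1 r * (pCons 1 (smult (- t) g) * s - 1) + ([:t:] * s) * f"
      unfolding one fu by (simp only: algebra_simps)
    then have mem: "monom 1 r * ([:d:] * s - 1) \<in> I"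
      using s f(1) by (simp only: add_mem mult_mem)
    define h where "h = monom 1 r * ([:d:] * s - 1)"
    obtain Q rest where QR: "pseudo_divmod h f = (Q, rest)" by force
    define L where "L = lead_coeff f ^ (Suc (degree h) - degree f)"
    have pd: "smult L h = f * Q + rest" "rest = 0 \<or> degree rest < degree f"
      using pseudo_divmod[OF f(2) QR] by (simp_all add: L_def)
    have "rest = [:L:] * h - Q * f" using pd(1) by (simp add: algebra_simps)
    then have "rest \<in> I" using mem f(1) by (simp only: h_def diff_mem mult_mem)
    then have "rest = 0" using pd(2) least by blast
    then have "[:L:] * h = f * Q" using pd(1) by simp
    then have "monom 1 r * ([:L:] * ([:d:] * s - 1)) = monom 1 r * (u * Q)"
      by (simp only: h_def fu ac_simps)
    then have "[:L:] * ([:d:] * s - 1) = u * Q"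
      by (metis mult_left_cancel monom_eq_0_iff zero_neq_one)
    then have "u * Q = [:- L:] + [:d:] * ([:L:] * s)" by (simp add: algebra_simps)
    then have "d dvd - L"
      by (rule dvd_const_if_multiple_const_modulo) (use cop False in \<open>auto simp: l_def\<close>)
    moreover have "lead_coeff f = l"
      unfolding fu l_def lead_coeff_mult by (simp add: degree_monom_eq)
    then have "coprime d L" using cop by (simp only: L_def coprime_power_right_iff simp_thms)
    ultimately have "is_unit d" by (simp add: coprime_absorb_left)
    then show ?thesis using d1 by simp
  qed
qed

theorem ex_power_mem: "\<exists>n. monom 1 n \<in> I"
proof -
  obtain e r where e: "e \<noteq> 0" "monom e r \<in> I" by (rule torsion_power_mem)
  have "monom \<bar>e\<bar> r \<in> I"
    using e(2) mult_mem[OF e(2), of "[:- 1:]"] by (auto simp: abs_if smult_monom)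
  then show ?thesis using power_mem_if_torsion[of "nat \<bar>e\<bar>" r] e(1) by simp
qed

end

section \<open>Evaluating integer polynomials in a ring without identity\<close>

primrec nat_scale :: "nat \<Rightarrow> 'a::ring \<Rightarrow> 'a" where
  "nat_scale 0 y = 0"
| "nat_scale (Suc n) y = y + nat_scale n y"

lemma nat_scale_add: "nat_scale (m + n) y = nat_scale m y + nat_scale n y"
  by (induction m) (simp_all add: add.assoc)

lemma nat_scale_add_right: "nat_scale n (y + z) = nat_scale n y + nat_scale n z"
  by (induction n) (simp_all add: algebra_simps)

lemma nat_scale_minus_right: "nat_scale n (- y) = - nat_scale n y"
  by (induction n) simp_all

lemma nat_scale_mult: "nat_scale (m * n) y = nat_scale m (nat_scale n y)"
  by (induction m) (simp_all add: nat_scale_add)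

lemma nat_scale_times: "nat_scale n (y * z) = nat_scale n y * z"
  by (induction n) (simp_all add: algebra_simps)

lemma times_nat_scale: "y * nat_scale n z = nat_scale n (y * z)"
  by (induction n) (simp_all add: algebra_simps)

definition int_scale :: "int \<Rightarrow> 'a::ring \<Rightarrow> 'a" where
  "int_scale k y = nat_scale (nat k) y - nat_scale (nat (- k)) y"

lemma int_scale_diff: "int_scale (int m - int n) y = nat_scale m y - nat_scale n y"
proof (cases "n \<le> m")
  case True
  then show ?thesis
    using nat_scale_add[of "m - n" n y] by (simp add: int_scale_def nat_diff_distrib)
next
  case False
  then show ?thesis
    using nat_scale_add[of "n - m" m y] by (simp add: int_scale_def nat_diff_distrib)
qed

lemma int_scale_0 [simp]: "int_scale 0 y = 0"
  by (simp add: int_scale_def)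

lemma int_scale_1 [simp]: "int_scale 1 y = y"
  by (simp add: int_scale_def)

lemma int_scale_add: "int_scale (k + l) y = int_scale k y + int_scale l y"
proof -
  obtain m n m' n' where kl: "k = int m - int n" "l = int m' - int n'"
    by (metis int_diff_cases)
  have "k + l = int (m + m') - int (n + n')" by (simp add: kl)
  then show ?thesis by (simp only: kl int_scale_diff nat_scale_add) (simp add: algebra_simps)
qed

lemma int_scale_mult: "int_scale (k * l) y = int_scale k (int_scale l y)"
proof -
  obtain m n m' n' where kl: "k = int m - int n" "l = int m' - int n'"
    by (metis int_diff_cases)
  have "k * l = int (m * m' + n * n') - int (m * n' + n * m')" by (simp add: kl algebra_simps)
  then have "int_scale (k * l) y = nat_scale (m * m' + n * n') y - nat_scale (m * n' + n * m') y"
    by (simp only: int_scale_diff)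
  also have "\<dots> = nat_scale m (nat_scale m' y + - nat_scale n' y)
      - nat_scale n (nat_scale m' y + - nat_scale n' y)"
    by (simp only: nat_scale_add nat_scale_mult nat_scale_add_right nat_scale_minus_right)
      (simp add: algebra_simps)
  also have "\<dots> = int_scale k (int_scale l y)" by (simp add: kl int_scale_diff)
  finally show ?thesis .
qed

lemma int_scale_add_right: "int_scale k (y + z) = int_scale k y + int_scale k z"
  by (simp add: int_scale_def nat_scale_add_right algebra_simps)

lemma int_scale_times: "int_scale k (y * z) = int_scale k y * z"
  by (simp add: int_scale_def nat_scale_times algebra_simps)

lemma times_int_scale: "y * int_scale k z = int_scale k (y * z)"
  by (simp add: int_scale_def times_nat_scale algebra_simps)

text \<open>A polynomial with a constant term has no value at \<open>a\<close> without an identity, but it still acts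
  on \<open>R\<close>, with \<open>X\<close> acting as left multiplication by \<open>a\<close>. Acting on \<open>y = a\<close> yields the values at
  \<open>a\<close> of the polynomials without constant term.\<close>

definition poly_act :: "'a::ring \<Rightarrow> int poly \<Rightarrow> 'a \<Rightarrow> 'a" where
  "poly_act a p y = fold_coeffs (\<lambda>c z. int_scale c y + a * z) p 0"

lemma poly_act_0 [simp]: "poly_act a 0 y = 0"
  by (simp add: poly_act_def)

lemma poly_act_pCons [simp]: "poly_act a (pCons c p) y = int_scale c y + a * poly_act a p y"
  by (cases "p = 0 \<and> c = 0") (auto simp: poly_act_def)

lemma poly_act_add: "poly_act a (p + q) y = poly_act a p y + poly_act a q y"
proof (induction p arbitrary: q)
  case (pCons c p)
  then show ?case by (cases q) (simp add: int_scale_add algebra_simps)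
qed simp

lemma poly_act_smult: "poly_act a (smult c p) y = int_scale c (poly_act a p y)"
proof (induction p)
  case 0
  show ?case using int_scale_mult[of c 0 y] by simp
next
  case (pCons b p)
  then show ?case by (simp add: int_scale_mult int_scale_add_right times_int_scale)
qed

lemma poly_act_uminus: "poly_act a (- p) y = - poly_act a p y"
  using poly_act_add[of a p "- p" y] by (simp add: minus_unique)

lemma poly_act_mult: "poly_act a (p * q) y = poly_act a p (poly_act a q y)"
  by (induction p) (simp_all add: poly_act_add poly_act_smult)

lemma poly_act_0_right [simp]: "poly_act a p 0 = 0"
  using poly_act_mult[of a p 0 0] by simp

lemma poly_act_times: "poly_act a p y * z = poly_act a p (y * z)"
  by (induction p) (simp_all add: int_scale_times algebra_simps)

lemma poly_act_monom: "poly_act a (monom 1 n) a = pow_Suc a n"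
  by (induction n) (simp_all add: monom_0 monom_Suc)

lemma poly_act_times_poly_act: "poly_act a p a * poly_act a q a = poly_act a (p * pCons 0 q) a"
  by (simp only: poly_act_times poly_act_mult poly_act_pCons) simp

text \<open>This is the subring generated by \<open>a\<close>.\<close>

lemma subring_range_poly_act: "subring (range (\<lambda>p. poly_act a p a))"
  unfolding subring_def
proof (intro conjI ballI; (elim rangeE)?)
  show "0 \<in> range (\<lambda>p. poly_act a p a)" by (rule range_eqI[of _ _ 0]) simp
qed (simp_all only: poly_act_times_poly_act flip: poly_act_add poly_act_uminus, (rule rangeI)+)

section \<open>Rings all of whose subrings are radical\<close>

theorem mainTheorem4:
  assumes "\<And>S :: 'a::ring set. subring S \<Longrightarrow> jacobson_radical_ring S"
  shows "nil_ring (UNIV :: 'a set)"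
proof -
  have "nilpotent_elem a" for a :: 'a
  proof -
    let ?I = "{p. poly_act a p a = 0}"
    interpret radical_poly_ideal ?I
    proof
      fix p
      have "\<forall>x\<in>range (\<lambda>p. poly_act a p a). \<exists>y\<in>range (\<lambda>p. poly_act a p a). x + y + x * y = 0"
        using assms[OF subring_range_poly_act] jacobson_radical_ring_iff[OF subring_range_poly_act]
        by blast
      then obtain q where "poly_act a p a + poly_act a q a + poly_act a p a * poly_act a q a = 0"
        by blast
      then have pq: "poly_act a (p + q + p * pCons 0 q) a = 0"
        by (simp add: poly_act_add poly_act_times_poly_act)
      \<comment> \<open>The quasi-inverse \<open>q(a) a\<close> of \<open>p(a) a\<close> turns \<open>1 + X q\<close> into the inverse of \<open>1 + X p\<close>.\<close>
      have "pCons 1 p * pCons 1 q - 1 = pCons 0 (p + q + p * pCons 0 q)"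
        by (simp add: algebra_simps one_pCons)
      then have "poly_act a (pCons 1 p * pCons 1 q - 1) a = 0"
        using pq by (simp only: poly_act_pCons) simp
      then show "\<exists>s. pCons 1 p * s - 1 \<in> ?I" by blast
    qed (simp_all add: poly_act_add poly_act_mult)
    obtain n where "poly_act a (monom 1 n) a = 0" using ex_power_mem by blast
    then show ?thesis by (auto simp: nilpotent_elem_def poly_act_monom)
  qed
  then show ?thesis by (simp add: nil_ring_def)
qed

end
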